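(* Let $K\subset\mathcal P(\mathbb R)$. Then the following statements are equivalent: (i) $K$ is tight, i.e. $\sup_{\mu\in K}\mu([-s,s]^c)\to0$ as $s\to\infty$. (ii) $K$ is $\leq_{\rm st}$-bounded, i.e. there exist $\underline\mu,\overline\mu\in\mathcal P(\mathbb R)$ with $\underline\mu\leq_{\rm st}\mu\leq_{\rm st}\overline\mu$ for all $\mu\in K$. (iii) Every nonempty subset of $K$ has a least upper bound and a greatest lower bound in $(\mathcal P(\mathbb R),\leq_{\rm st})$. (iv) There exists a nondecreasing function $\psi\colon[0,\infty)\to[0,\infty)$ with $\psi(0)=0$, $\psi(s)\to\infty$ as $s\to\infty$ and $$\sup_{\mu\in K}\int_{\mathbb R}\psi(|x|)\,d\mu(x)<\infty.$$ The function $\psi$ in (iv) can be chosen to be continuous and strictly increasing. Moreover, the function $\psi$ can be chosen to be convex if and only if $$\sup_{\mu\in K}\int_{\mathbb R}|x|\,d\mu(x)<\infty.$$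
   Context: $\mathcal P(\mathbb R)$ is the set of all Borel probability measures on $\mathbb R$. For $\mu\in\mathcal P(\mathbb R)$ let $\mu_0(s):=\mu((s,\infty))$, $s\in\mathbb R$. First order stochastic dominance is the partial order on $\mathcal P(\mathbb R)$ given by $\mu\leq_{\rm st}\nu$ iff $\mu_0(s)\leq\nu_0(s)$ for all $s\in\mathbb R$. *)

theory Defs
  imports "HOL-Probability.Probability" "HOL-Algebra.Order"
begin

text \<open>
  Borel probability measures on the reals are the measures satisfying the library locale predicate
  \<^const>\<open>real_distribution\<close>, which requires the sigma-algebra to be exactly the Borel one.
\<close>

definition borel_probs :: "real measure set" where
  "borel_probs = {\<mu>. real_distribution \<mu>}"

definition survival :: "real measure \<Rightarrow> real \<Rightarrow> real" where
  "survival \<mu> s = measure \<mu> {s<..}"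

definition st_le :: "real measure \<Rightarrow> real measure \<Rightarrow> bool"  (infix \<open>\<le>\<^sub>s\<^sub>t\<close> 50) where
  "\<mu> \<le>\<^sub>s\<^sub>t \<nu> \<longleftrightarrow> (\<forall>s. survival \<mu> s \<le> survival \<nu> s)"

definition st_order :: "real measure gorder" where
  "st_order = \<lparr>carrier = borel_probs, eq = (=), le = (\<le>\<^sub>s\<^sub>t)\<rparr>"

lemma partial_order_st_order: "partial_order st_order"
proof
  fix \<mu> \<nu>
  assume le: "\<mu> \<sqsubseteq>\<^bsub>st_order\<^esub> \<nu>" "\<nu> \<sqsubseteq>\<^bsub>st_order\<^esub> \<mu>"
    and carr: "\<mu> \<in> carrier st_order" "\<nu> \<in> carrier st_order"
  interpret M: real_distribution \<mu> using carr by (simp add: st_order_def borel_probs_def)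
  interpret N: real_distribution \<nu> using carr by (simp add: st_order_def borel_probs_def)
  have eq: "survival \<mu> s = survival \<nu> s" for s
    using le by (auto simp: st_order_def st_le_def intro: antisym)
  have compl: "- {s<..} = {..s}" for s :: real
    by auto
  have "cdf \<mu> s = cdf \<nu> s" for s
    using M.prob_compl[of "{s<..}"] N.prob_compl[of "{s<..}"] eq[of s]
    by (simp add: cdf_def survival_def Compl_eq_Diff_UNIV[symmetric] compl)
  then have "\<mu> = \<nu>"
    by (intro cdf_unique M.real_distribution_axioms N.real_distribution_axioms ext)
  then show "\<mu> .=\<^bsub>st_order\<^esub> \<nu>"
    by (simp add: st_order_def)
qed (auto simp: st_order_def st_le_def intro: order_trans)

text \<open>
  The suprema below are taken in \<^typ>\<open>ennreal\<close>, so that the supremum over the empty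
  family is 0 and suprema and integrals may take the value \<infinity>.
\<close>

definition tight_family :: "real measure set \<Rightarrow> bool" where
  "tight_family K \<longleftrightarrow> ((\<lambda>s. \<Squnion>\<mu>\<in>K. emeasure \<mu> (- {- s..s})) \<longlongrightarrow> 0) at_top"

definition st_bounded :: "real measure set \<Rightarrow> bool" where
  "st_bounded K \<longleftrightarrow>
     (\<exists>\<mu>l\<in>borel_probs. \<exists>\<mu>u\<in>borel_probs. \<forall>\<mu>\<in>K. \<mu>l \<le>\<^sub>s\<^sub>t \<mu> \<and> \<mu> \<le>\<^sub>s\<^sub>t \<mu>u)"

definition subsets_have_lub_glb :: "real measure set \<Rightarrow> bool" where
  "subsets_have_lub_glb K \<longleftrightarrow>
     (\<forall>A. A \<subseteq> K \<and> A \<noteq> {} \<longrightarrow>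
        (\<exists>\<mu>. least st_order \<mu> (Upper st_order A)) \<and>
        (\<exists>\<mu>. greatest st_order \<mu> (Lower st_order A)))"

text \<open>
  A function on the nonnegative half-line is represented by a total function on the reals
  whose values at negative arguments are irrelevant: it is only ever constrained on
  \<open>{0..}\<close> and evaluated at \<open>\<bar>x\<bar>\<close>.
\<close>

definition bounding_function :: "real measure set \<Rightarrow> (real \<Rightarrow> real) \<Rightarrow> bool" where
  "bounding_function K \<psi> \<longleftrightarrow>
     \<psi> \<in> {0..} \<rightarrow> {0..} \<and> mono_on {0..} \<psi> \<and> \<psi> 0 = 0 \<and> filterlim \<psi> at_top at_top \<and>
     (\<Squnion>\<mu>\<in>K. \<integral>\<^sup>+x. ennreal (\<psi> \<bar>x\<bar>) \<partial>\<mu>) < \<infinity>"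

end

theory Submission
  imports Defs
begin

text \<open>
  The distribution functions of a tight family have infimum and supremum tending to 0 and 1 at the
  two ends; the right-continuous modifications of these are again distribution functions, and they
  belong to the least upper and the greatest lower bound of the family. As subfamilies of tight
  families are tight, (i) implies (iii). Applying (iii) to the whole family gives (ii), and the
  tails of the two bounds give (i) back. For (iv), pick levels \<open>s n \<ge> n\<close> at which all tails are below
  \<open>2\<^sup>-\<^sup>n\<close> and sum the unit ramps starting at \<open>s n\<close>; adding \<open>1 - exp (- x)\<close> makes the sum strictly
  increasing. The converse is Markov's inequality. A convex \<open>\<psi>\<close> grows at least linearly.
\<close>

section \<open>Distribution functions and the stochastic order\<close>

lemma borel_probsD: "\<mu> \<in> borel_probs \<Longrightarrow> real_distribution \<mu>"
  by (simp add: borel_probs_def)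

lemma survival_eq_cdf:
  assumes "\<mu> \<in> borel_probs"
  shows "survival \<mu> s = 1 - cdf \<mu> s"
proof -
  interpret real_distribution \<mu> using assms by (rule borel_probsD)
  have "{s<..} = space \<mu> - {..s}" by auto
  then show ?thesis
    using prob_compl[of "{..s}"] by (simp add: survival_def cdf_def)
qed

text \<open>Passing to complements reverses the inequality, so upper bounds in the stochastic order
  are pointwise lower bounds of distribution functions.\<close>

lemma st_le_iff_cdf:
  assumes "\<mu> \<in> borel_probs" "\<nu> \<in> borel_probs"
  shows "\<mu> \<le>\<^sub>s\<^sub>t \<nu> \<longleftrightarrow> (\<forall>s. cdf \<nu> s \<le> cdf \<mu> s)"
  using assms by (simp add: st_le_def survival_eq_cdf)

lemma cdf_mono: "\<mu> \<in> borel_probs \<Longrightarrow> x \<le> y \<Longrightarrow> cdf \<mu> x \<le> cdf \<mu> y"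
  by (simp add: borel_probsD finite_borel_measure.cdf_nondecreasing real_distribution.finite_borel_measure_M)

lemma cdf_in_01:
  assumes "\<mu> \<in> borel_probs"
  shows "0 \<le> cdf \<mu> x" "cdf \<mu> x \<le> 1"
  using assms
  by (auto simp: cdf_def borel_probsD real_distribution.cdf_bounded_prob[unfolded cdf_def])

lemma cdf_small:
  assumes "\<mu> \<in> borel_probs" "0 < e"
  obtains s where "cdf \<mu> s < e"
proof -
  interpret real_distribution \<mu> using assms(1) by (rule borel_probsD)
  from order_tendstoD(2)[OF cdf_lim_at_bot assms(2)] that show ?thesis
    by (auto simp: eventually_at_bot_linorder)
qed

lemma cdf_large:
  assumes "\<mu> \<in> borel_probs" "e < 1"
  obtains s where "e < cdf \<mu> s"
proof -
  interpret real_distribution \<mu> using assms(1) by (rule borel_probsD)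
  from order_tendstoD(1)[OF cdf_lim_at_top_prob assms(2)] that show ?thesis
    by (auto simp: eventually_at_top_linorder)
qed

text \<open>Right continuity of \<open>cdf \<mu>\<close> carries the bound down to \<open>s\<close>.
  This absorbs the loss from \<open>s\<close> to \<open>t > s\<close> that a right-continuous
  modification causes.\<close>

lemma le_cdf_if_le_cdf_right:
  assumes "\<mu> \<in> borel_probs" "\<And>t. s < t \<Longrightarrow> a \<le> cdf \<mu> t"
  shows "a \<le> cdf \<mu> s"
proof -
  interpret real_distribution \<mu> using assms(1) by (rule borel_probsD)
  have "(cdf \<mu> \<longlongrightarrow> cdf \<mu> s) (at_right s)"
    using cdf_is_right_cont by (simp add: continuous_within)
  then show ?thesis
    by (rule tendsto_lowerbound) (auto simp: eventually_at_filter assms(2))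
qed

text \<open>The measure below is the one with distribution function \<open>s \<mapsto> inf {G t | t > s}\<close>.\<close>

lemma ex_borel_prob_cdf_between:
  fixes G :: "real \<Rightarrow> real"
  assumes mono: "mono G" and bot: "(G \<longlongrightarrow> 0) at_bot" and top: "(G \<longlongrightarrow> 1) at_top"
  obtains \<nu> where "\<nu> \<in> borel_probs" "\<And>s. G s \<le> cdf \<nu> s" "\<And>s t. s < t \<Longrightarrow> cdf \<nu> s \<le> G t"
proof -
  define F where "F s = (INF t\<in>{s<..}. G t)" for s
  have bdd: "bdd_below (G ` {s<..})" for s
    by (rule bdd_belowI[of _ "G s"]) (auto intro: monoD[OF mono])
  have FG: "F s \<le> G t" if "s < t" for s t
    unfolding F_def by (rule cINF_lower[OF bdd]) (use that in auto)
  have GF: "G s \<le> F s" for s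
    unfolding F_def by (rule cINF_greatest) (auto intro: monoD[OF mono])
  have F_mono: "F x \<le> F y" if "x \<le> y" for x y
    unfolding F_def using that by (intro cINF_superset_mono[OF _ bdd]) auto
  have right: "continuous (at_right x) F" for x
    unfolding continuous_within
  proof (rule order_tendstoI)
    fix a assume "a < F x"
    then have "a < F y" if "x < y" for y
      using F_mono[of x y] that by linarith
    then show "\<forall>\<^sub>F y in at_right x. a < F y"
      by (simp add: eventually_at_filter)
  next
    fix a assume "F x < a"
    \<comment> \<open>An infimum below \<open>a\<close> has a witness \<open>t\<close>, and
      \<open>F y \<le> G t\<close> for every \<open>y\<close> between \<open>x\<close> and
      \<open>t\<close>.\<close>
    then obtain t where t: "x < t" "G t < a"
      unfolding F_def using cINF_less_iff[OF _ bdd, of x a] by auto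
    show "\<forall>\<^sub>F y in at_right x. F y < a"
      unfolding eventually_at_right_field using t FG le_less_trans by blast
  qed
  have F_bot: "(F \<longlongrightarrow> 0) at_bot"
  \<comment> \<open>\<open>F s\<close> lies between \<open>G s\<close> and \<open>G (s + 1)\<close>,
    and a unit shift does not affect limits at either end.\<close>
  proof (rule tendsto_sandwich[OF _ _ bot])
    have "filterlim (\<lambda>s::real. s + 1) at_bot at_bot"
      by (simp add: filterlim_at_bot eventually_at_bot_linorder) (metis le_diff_eq)
    then show "((\<lambda>s. G (s + 1)) \<longlongrightarrow> 0) at_bot"
      by (rule filterlim_compose[OF bot])
  qed (auto simp: GF FG)
  have F_top: "(F \<longlongrightarrow> 1) at_top"
  proof (rule tendsto_sandwich[OF _ _ top])
    have "filterlim (\<lambda>s::real. s + 1) at_top at_top"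
      by (rule filterlim_at_top_mono[OF filterlim_ident]) auto
    then show "((\<lambda>s. G (s + 1)) \<longlongrightarrow> 1) at_top"
      by (rule filterlim_compose[OF top])
  qed (auto simp: GF FG)
  have "interval_measure F \<in> borel_probs"
    unfolding borel_probs_def using real_distribution_interval_measure[OF F_mono right F_bot F_top] by simp
  moreover have "cdf (interval_measure F) = F"
    by (rule cdf_interval_measure[OF F_mono right F_bot])
  ultimately show thesis using that GF FG by metis
qed

lemma tendsto_0_at_botI:
  fixes G :: "real \<Rightarrow> real"
  assumes "mono G" "\<And>s. 0 \<le> G s" "\<And>e. 0 < e \<Longrightarrow> \<exists>s. G s < e"
  shows "(G \<longlongrightarrow> 0) at_bot"
proof (rule order_tendstoI)
  fix a :: real assume "a < 0"
  then have "a < G s" for s using assms(2)[of s] by linarith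
  then show "\<forall>\<^sub>F s in at_bot. a < G s" by simp
next
  fix a :: real assume "0 < a"
  then obtain s where "G s < a" using assms(3) by blast
  then show "\<forall>\<^sub>F s in at_bot. G s < a"
    unfolding eventually_at_bot_linorder using monoD[OF assms(1)] le_less_trans by blast
qed

lemma tendsto_1_at_topI:
  fixes G :: "real \<Rightarrow> real"
  assumes "mono G" "\<And>s. G s \<le> 1" "\<And>e. 0 < e \<Longrightarrow> \<exists>s. 1 - e \<le> G s"
  shows "(G \<longlongrightarrow> 1) at_top"
proof (rule order_tendstoI)
  fix a :: real assume "1 < a"
  then have "G s < a" for s using assms(2)[of s] by linarith
  then show "\<forall>\<^sub>F s in at_top. G s < a" by simp
next
  fix a :: real assume "a < 1"
  \<comment> \<open>Half of the gap \<open>1 - a\<close> is used because the hypothesis gives a weak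
    inequality and a strict one is wanted.\<close>
  then obtain s where "1 - (1 - a) / 2 \<le> G s" using assms(3)[of "(1 - a) / 2"] by auto
  then have "a < G s" using \<open>a < 1\<close> by (simp add: field_simps)
  then show "\<forall>\<^sub>F s in at_top. a < G s"
    unfolding eventually_at_top_linorder using monoD[OF assms(1)] less_le_trans by blast
qed

section \<open>Least upper and greatest lower bounds of families\<close>

text \<open>The candidate comes from the pointwise infimum \<open>G\<close> of the distribution
  functions. A single member forces the limit 0 of \<open>G\<close> at the left end; the limit 1 at
  the right end is where the uniformity in \<open>unif\<close> enters.\<close>

lemma ex_least_Upper_st_order:
  assumes sub: "A \<subseteq> borel_probs" and ne: "A \<noteq> {}"
    and unif: "\<And>e. 0 < e \<Longrightarrow> \<exists>s. \<forall>\<mu>\<in>A. 1 - e \<le> cdf \<mu> s"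
  shows "\<exists>\<mu>. least st_order \<mu> (Upper st_order A)"
proof -
  define G where "G s = (INF \<mu>\<in>A. cdf \<mu> s)" for s
  have bdd: "bdd_below ((\<lambda>\<mu>. cdf \<mu> s) ` A)" for s
    by (rule bdd_belowI[of _ 0]) (use sub cdf_in_01 in auto)
  have G_le: "G s \<le> cdf \<mu> s" if "\<mu> \<in> A" for \<mu> s
    unfolding G_def using bdd that by (rule cINF_lower)
  have le_G: "a \<le> G s" if "\<And>\<mu>. \<mu> \<in> A \<Longrightarrow> a \<le> cdf \<mu> s" for a s
    unfolding G_def by (rule cINF_greatest[OF ne that])
  obtain \<alpha> where \<alpha>: "\<alpha> \<in> A" "\<alpha> \<in> borel_probs" using ne sub by auto
  have "mono G"
  proof (rule monoI, rule le_G)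
    fix x y :: real and \<mu> assume "x \<le> y" "\<mu> \<in> A"
    then show "G x \<le> cdf \<mu> y"
      using G_le[of \<mu> x] cdf_mono[of \<mu> x y] sub by auto
  qed
  moreover have "(G \<longlongrightarrow> 0) at_bot"
  proof (rule tendsto_0_at_botI[OF \<open>mono G\<close>])
    show "0 \<le> G s" for s
      using sub cdf_in_01 by (intro le_G) auto
    show "\<exists>s. G s < e" if "0 < e" for e
      using cdf_small[OF \<alpha>(2) that] G_le[OF \<alpha>(1)] le_less_trans by metis
  qed
  moreover have "(G \<longlongrightarrow> 1) at_top"
  proof (rule tendsto_1_at_topI[OF \<open>mono G\<close>])
    show "G s \<le> 1" for s
      using G_le[OF \<alpha>(1)] cdf_in_01[OF \<alpha>(2)] order_trans by metis
    show "\<exists>s. 1 - e \<le> G s" if "0 < e" for e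
      using unif[OF that] le_G by metis
  qed
  ultimately obtain \<nu> where \<nu>: "\<nu> \<in> borel_probs" "\<And>s. G s \<le> cdf \<nu> s" "\<And>s t. s < t \<Longrightarrow> cdf \<nu> s \<le> G t"
    using ex_borel_prob_cdf_between by metis
  have "\<mu> \<le>\<^sub>s\<^sub>t \<nu>" if "\<mu> \<in> A" for \<mu>
  proof -
    have \<mu>: "\<mu> \<in> borel_probs" using that sub by blast
    \<comment> \<open>For all \<open>t > s\<close> one has
      \<open>cdf \<nu> s \<le> G t \<le> cdf \<mu> t\<close>; now let \<open>t\<close> decrease to
      \<open>s\<close>.\<close>
    have "cdf \<nu> s \<le> cdf \<mu> s" for s
      by (rule le_cdf_if_le_cdf_right[OF \<mu> order_trans[OF \<nu>(3) G_le[OF that]]])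
    then show ?thesis using \<nu>(1) \<mu> by (simp add: st_le_iff_cdf)
  qed
  moreover have "\<nu> \<le>\<^sub>s\<^sub>t \<theta>" if "\<theta> \<in> borel_probs" "\<And>\<mu>. \<mu> \<in> A \<Longrightarrow> \<mu> \<le>\<^sub>s\<^sub>t \<theta>" for \<theta>
  proof -
    have "cdf \<theta> s \<le> cdf \<mu> s" if "\<mu> \<in> A" for \<mu> s
      using that sub \<open>\<theta> \<in> borel_probs\<close> \<open>\<And>\<mu>. \<mu> \<in> A \<Longrightarrow> \<mu> \<le>\<^sub>s\<^sub>t \<theta>\<close> st_le_iff_cdf by blast
    then have "cdf \<theta> s \<le> G s" for s
      by (rule le_G)
    then show ?thesis
      using \<nu>(1,2) that(1) by (auto simp: st_le_iff_cdf intro: order_trans)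
  qed
  ultimately have "least st_order \<nu> (Upper st_order A)"
    using \<nu>(1) sub by (auto simp: least_def Upper_def st_order_def)
  then show ?thesis ..
qed

text \<open>Dually, \<open>G\<close> is the pointwise supremum, with the roles of the two ends
  exchanged. A supremum of right-continuous functions may fail to be right-continuous, so
  \<open>cdf \<nu>\<close> can lie strictly above \<open>G\<close> at some points.\<close>

lemma ex_greatest_Lower_st_order:
  assumes sub: "A \<subseteq> borel_probs" and ne: "A \<noteq> {}"
    and unif: "\<And>e. 0 < e \<Longrightarrow> \<exists>s. \<forall>\<mu>\<in>A. cdf \<mu> s \<le> e"
  shows "\<exists>\<mu>. greatest st_order \<mu> (Lower st_order A)"
proof -
  define G where "G s = (SUP \<mu>\<in>A. cdf \<mu> s)" for s
  have bdd: "bdd_above ((\<lambda>\<mu>. cdf \<mu> s) ` A)" for s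
    by (rule bdd_aboveI[of _ 1]) (use sub cdf_in_01 in auto)
  have le_G: "cdf \<mu> s \<le> G s" if "\<mu> \<in> A" for \<mu> s
    unfolding G_def using that bdd by (rule cSUP_upper)
  have G_le: "G s \<le> a" if "\<And>\<mu>. \<mu> \<in> A \<Longrightarrow> cdf \<mu> s \<le> a" for a s
    unfolding G_def by (rule cSUP_least[OF ne that])
  obtain \<alpha> where \<alpha>: "\<alpha> \<in> A" "\<alpha> \<in> borel_probs" using ne sub by auto
  have "mono G"
  proof (rule monoI, rule G_le)
    fix x y :: real and \<mu> assume "x \<le> y" "\<mu> \<in> A"
    then show "cdf \<mu> x \<le> G y"
      using le_G[of \<mu> y] cdf_mono[of \<mu> x y] sub by auto
  qed
  moreover have "(G \<longlongrightarrow> 0) at_bot"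
  proof (rule tendsto_0_at_botI[OF \<open>mono G\<close>])
    show "0 \<le> G s" for s
      using le_G[OF \<alpha>(1)] cdf_in_01[OF \<alpha>(2)] order_trans by metis
    show "\<exists>s. G s < e" if "0 < e" for e
    proof -
      obtain s where "\<forall>\<mu>\<in>A. cdf \<mu> s \<le> e / 2" using unif[of "e / 2"] \<open>0 < e\<close> by auto
      then have "G s \<le> e / 2" using G_le by blast
      then show ?thesis using that by (intro exI[of _ s]) simp
    qed
  qed
  moreover have "(G \<longlongrightarrow> 1) at_top"
  proof (rule tendsto_1_at_topI[OF \<open>mono G\<close>])
    show "G s \<le> 1" for s
      using sub cdf_in_01 by (intro G_le) auto
    show "\<exists>s. 1 - e \<le> G s" if "0 < e" for e
    proof -
      obtain s where "1 - e < cdf \<alpha> s" using cdf_large[OF \<alpha>(2), of "1 - e"] \<open>0 < e\<close> by auto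
      then show ?thesis using le_G[OF \<alpha>(1), of s] by (intro exI[of _ s]) simp
    qed
  qed
  ultimately obtain \<nu> where \<nu>: "\<nu> \<in> borel_probs" "\<And>s. G s \<le> cdf \<nu> s" "\<And>s t. s < t \<Longrightarrow> cdf \<nu> s \<le> G t"
    using ex_borel_prob_cdf_between by metis
  have "\<nu> \<le>\<^sub>s\<^sub>t \<mu>" if "\<mu> \<in> A" for \<mu>
    using that sub \<nu>(1) order_trans[OF le_G[OF that] \<nu>(2)] by (subst st_le_iff_cdf) auto
  moreover have "\<theta> \<le>\<^sub>s\<^sub>t \<nu>" if "\<theta> \<in> borel_probs" "\<And>\<mu>. \<mu> \<in> A \<Longrightarrow> \<theta> \<le>\<^sub>s\<^sub>t \<mu>" for \<theta>
  proof -
    have "cdf \<mu> s \<le> cdf \<theta> s" if "\<mu> \<in> A" for \<mu> s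
      using that sub \<open>\<theta> \<in> borel_probs\<close> \<open>\<And>\<mu>. \<mu> \<in> A \<Longrightarrow> \<theta> \<le>\<^sub>s\<^sub>t \<mu>\<close> st_le_iff_cdf by blast
    then have "G s \<le> cdf \<theta> s" for s
      by (rule G_le)
    \<comment> \<open>Although \<open>cdf \<nu>\<close> may exceed \<open>G\<close>, it stays below
      the right-continuous \<open>cdf \<theta>\<close>, which dominates \<open>G\<close>.\<close>
    from order_trans[OF \<nu>(3) this] have "cdf \<nu> s \<le> cdf \<theta> s" for s
      by (rule le_cdf_if_le_cdf_right[OF that(1)])
    then show ?thesis
      using \<nu>(1) that(1) by (simp add: st_le_iff_cdf)
  qed
  ultimately have "greatest st_order \<nu> (Lower st_order A)"
    using \<nu>(1) sub by (auto simp: greatest_def Lower_def st_order_def)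
  then show ?thesis ..
qed

section \<open>Tightness and order bounds\<close>

text \<open>Tails shrink as \<open>s\<close> grows, so one good level for each \<open>e\<close>
  already gives the limit. This replaces suprema in \<open>ennreal\<close> by real
  inequalities.\<close>

lemma tight_family_iff:
  assumes "K \<subseteq> borel_probs"
  shows "tight_family K \<longleftrightarrow> (\<forall>e>0. \<exists>s. \<forall>\<mu>\<in>K. measure \<mu> (- {- s..s}) \<le> e)"
proof
  assume tight: "tight_family K"
  show "\<forall>e>0. \<exists>s. \<forall>\<mu>\<in>K. measure \<mu> (- {- s..s}) \<le> e"
  proof (intro allI impI)
    fix e :: real assume "0 < e"
    then have "\<forall>\<^sub>F s in at_top. (\<Squnion>\<mu>\<in>K. emeasure \<mu> (- {- s..s})) < ennreal e"
      using tight unfolding tight_family_def by (intro order_tendstoD(2)[of _ 0]) auto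
    then obtain s where s: "(\<Squnion>\<mu>\<in>K. emeasure \<mu> (- {- s..s})) < ennreal e"
      by (auto simp: eventually_at_top_linorder)
    have "measure \<mu> (- {- s..s}) \<le> e" if "\<mu> \<in> K" for \<mu>
    proof -
      interpret real_distribution \<mu> using assms that by (auto intro: borel_probsD)
      have "emeasure \<mu> (- {- s..s}) \<le> ennreal e"
        using s that by (intro order_trans[OF SUP_upper less_imp_le[OF s]])
      then show ?thesis using \<open>0 < e\<close> by (simp add: emeasure_eq_measure)
    qed
    then show "\<exists>s. \<forall>\<mu>\<in>K. measure \<mu> (- {- s..s}) \<le> e" by blast
  qed
next
  assume *: "\<forall>e>0. \<exists>s. \<forall>\<mu>\<in>K. measure \<mu> (- {- s..s}) \<le> e"
  show "tight_family K"
    unfolding tight_family_def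
  proof (rule order_tendstoI)
    fix a :: ennreal assume "0 < a"
    \<comment> \<open>The intermediate \<open>b\<close> is finite even if \<open>a\<close> is
      infinite, and it keeps the supremum strictly below \<open>a\<close>.\<close>
    then obtain b where b: "0 < b" "b < a" using dense by blast
    define e where "e = enn2real b"
    have e: "b = ennreal e" "0 < e"
      using b less_le_trans[OF b(2) top_greatest] by (auto simp: e_def enn2real_positive_iff)
    obtain s0 where s0: "\<forall>\<mu>\<in>K. measure \<mu> (- {- s0..s0}) \<le> e" using * e by blast
    have "(\<Squnion>\<mu>\<in>K. emeasure \<mu> (- {- s..s})) < a" if "s0 \<le> s" for s
    proof (rule le_less_trans[OF _ b(2)], rule SUP_least)
      fix \<mu> assume \<mu>: "\<mu> \<in> K"
      interpret real_distribution \<mu> using assms \<mu> by (auto intro: borel_probsD)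
      have "measure \<mu> (- {- s..s}) \<le> measure \<mu> (- {- s0..s0})"
        using that by (intro finite_measure_mono) auto
      also have "\<dots> \<le> e" using s0 \<mu> by blast
      finally show "emeasure \<mu> (- {- s..s}) \<le> b"
        by (simp add: emeasure_eq_measure e(1) ennreal_leI)
    qed
    then show "\<forall>\<^sub>F s in at_top. (\<Squnion>\<mu>\<in>K. emeasure \<mu> (- {- s..s})) < a"
      by (auto simp: eventually_at_top_linorder)
  qed auto
qed

text \<open>The shift by 1 is there because \<open>{..- s}\<close> contains the point
  \<open>- s\<close>, which for \<open>s \<ge> 0\<close> is missing from the complement of the
  closed interval.\<close>

lemma cdf_le_tail:
  assumes "\<mu> \<in> borel_probs"
  shows "cdf \<mu> (- s - 1) \<le> measure \<mu> (- {- s..s})" "1 - measure \<mu> (- {- s..s}) \<le> cdf \<mu> s"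
proof -
  interpret real_distribution \<mu> using assms by (rule borel_probsD)
  show "cdf \<mu> (- s - 1) \<le> measure \<mu> (- {- s..s})"
    unfolding cdf_def by (intro finite_measure_mono) auto
  have "survival \<mu> s \<le> measure \<mu> (- {- s..s})"
    unfolding survival_def by (intro finite_measure_mono) auto
  then show "1 - measure \<mu> (- {- s..s}) \<le> cdf \<mu> s"
    using assms by (simp add: survival_eq_cdf)
qed

text \<open>Union bound over the two half-lines \<open>{..- s}\<close> and
  \<open>{s<..}\<close>.\<close>

lemma tail_le_cdf:
  assumes "\<mu> \<in> borel_probs"
  shows "measure \<mu> (- {- s..s}) \<le> cdf \<mu> (- s) + (1 - cdf \<mu> s)"
proof -
  interpret real_distribution \<mu> using assms by (rule borel_probsD)
  have "measure \<mu> (- {- s..s}) \<le> measure \<mu> ({..- s} \<union> {s<..})"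
    by (intro finite_measure_mono) auto
  also have "\<dots> \<le> measure \<mu> {..- s} + measure \<mu> {s<..}"
    by (intro measure_Un_le) auto
  finally show ?thesis
    using survival_eq_cdf[OF assms, of s] by (simp add: survival_def cdf_def)
qed

text \<open>Tail bounds for \<open>K\<close> pass to \<open>A\<close>; the right tails yield the
  least upper bound and the left tails the greatest lower bound.\<close>

lemma tight_imp_subsets_have_lub_glb:
  assumes K: "K \<subseteq> borel_probs" and tight: "tight_family K"
  shows "subsets_have_lub_glb K"
  unfolding subsets_have_lub_glb_def
proof (intro allI impI)
  fix A assume "A \<subseteq> K \<and> A \<noteq> {}"
  then have A: "A \<subseteq> borel_probs" "A \<noteq> {}" "A \<subseteq> K" using K by auto
  have tail: "\<exists>s. \<forall>\<mu>\<in>A. measure \<mu> (- {- s..s}) \<le> e" if "0 < e" for e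
    using tight that A(3) unfolding tight_family_iff[OF K] by blast
  have "\<exists>s. \<forall>\<mu>\<in>A. 1 - e \<le> cdf \<mu> s" if "0 < e" for e
  proof -
    obtain s where s: "\<forall>\<mu>\<in>A. measure \<mu> (- {- s..s}) \<le> e" using tail[OF \<open>0 < e\<close>] by blast
    have "1 - e \<le> cdf \<mu> s" if "\<mu> \<in> A" for \<mu>
      using s that cdf_le_tail(2)[of \<mu> s] A(1) by fastforce
    then show ?thesis by blast
  qed
  moreover have "\<exists>s. \<forall>\<mu>\<in>A. cdf \<mu> s \<le> e" if "0 < e" for e
  proof -
    obtain s where s: "\<forall>\<mu>\<in>A. measure \<mu> (- {- s..s}) \<le> e" using tail[OF \<open>0 < e\<close>] by blast
    have "cdf \<mu> (- s - 1) \<le> e" if "\<mu> \<in> A" for \<mu>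
      using s that cdf_le_tail(1)[of \<mu> s] A(1) by fastforce
    then show ?thesis by blast
  qed
  ultimately show "(\<exists>\<mu>. least st_order \<mu> (Upper st_order A)) \<and> (\<exists>\<mu>. greatest st_order \<mu> (Lower st_order A))"
    using ex_least_Upper_st_order[OF A(1,2)] ex_greatest_Lower_st_order[OF A(1,2)] by blast
qed

lemma subsets_have_lub_glb_imp_st_bounded:
  assumes K: "K \<subseteq> borel_probs" and lub_glb: "subsets_have_lub_glb K"
  shows "st_bounded K"
proof (cases "K = {}")
  \<comment> \<open>The empty family has no nonempty subset to apply the hypothesis to; the Dirac
    measure at 0 serves as both bounds.\<close>
  case True
  interpret prob_space "return borel (0::real)" by (rule prob_space_return) simp
  have "return borel (0::real) \<in> borel_probs"
    by (simp add: borel_probs_def real_distribution_def real_distribution_axioms_def prob_space_axioms)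
  then show ?thesis using True by (auto simp: st_bounded_def)
next
  case False
  then obtain u l where "least st_order u (Upper st_order K)" "greatest st_order l (Lower st_order K)"
    using lub_glb unfolding subsets_have_lub_glb_def by blast
  then have "u \<in> borel_probs" "l \<in> borel_probs" "\<forall>\<mu>\<in>K. l \<le>\<^sub>s\<^sub>t \<mu> \<and> \<mu> \<le>\<^sub>s\<^sub>t u"
    using K by (auto simp: least_def greatest_def Upper_def Lower_def st_order_def)
  then show ?thesis unfolding st_bounded_def by blast
qed

text \<open>The lower bound \<open>l\<close> controls all left tails and the upper bound
  \<open>u\<close> all right tails, each up to \<open>e / 2\<close>.\<close>

lemma st_bounded_imp_tight:
  assumes K: "K \<subseteq> borel_probs" and bounded: "st_bounded K"
  shows "tight_family K"
  unfolding tight_family_iff[OF K]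
proof (intro allI impI)
  fix e :: real assume "0 < e"
  obtain l u where l: "l \<in> borel_probs" and u: "u \<in> borel_probs"
    and between: "\<And>\<mu>. \<mu> \<in> K \<Longrightarrow> l \<le>\<^sub>s\<^sub>t \<mu> \<and> \<mu> \<le>\<^sub>s\<^sub>t u"
    using bounded unfolding st_bounded_def by blast
  obtain a where a: "cdf l a < e / 2" using cdf_small[OF l, of "e / 2"] \<open>0 < e\<close> by auto
  obtain b where b: "1 - e / 2 < cdf u b" using cdf_large[OF u, of "1 - e / 2"] \<open>0 < e\<close> by auto
  define s where "s = max (- a) b"
  have "measure \<mu> (- {- s..s}) \<le> e" if \<mu>: "\<mu> \<in> K" for \<mu>
  proof -
    have \<mu>': "\<mu> \<in> borel_probs" using K \<mu> by auto
    have "cdf \<mu> (- s) \<le> cdf l a"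
      using between[OF \<mu>] l \<mu>' cdf_mono[OF l, of "- s" a]
      by (auto simp: st_le_iff_cdf s_def intro: order_trans)
    moreover have "cdf u b \<le> cdf \<mu> s"
      using between[OF \<mu>] u \<mu>' cdf_mono[OF u, of b s]
      by (auto simp: st_le_iff_cdf s_def intro: order_trans)
    ultimately show ?thesis
      using tail_le_cdf[OF \<mu>', of s] a b by linarith
  qed
  then show "\<exists>s. \<forall>\<mu>\<in>K. measure \<mu> (- {- s..s}) \<le> e" by blast
qed

section \<open>Integrable growth functions and tightness\<close>

text \<open>Each summand climbs from 0 to 1 between \<open>s n\<close> and \<open>s n + 1\<close>, a
  continuous substitute for the indicator of \<open>{s n<..}\<close>.\<close>

definition ramp_sum :: "(nat \<Rightarrow> real) \<Rightarrow> real \<Rightarrow> real" where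
  "ramp_sum s x = (\<Sum>n. min 1 (max 0 (x - s n)))"

context
  fixes s :: "nat \<Rightarrow> real"
  assumes real_le: "real n \<le> s n"
begin

lemma ramp_eq_0: "x \<le> real n \<Longrightarrow> min 1 (max 0 (x - s n)) = 0"
  using real_le[of n] by auto

text \<open>The levels satisfy \<open>s n \<ge> n\<close>, so ramps with \<open>n \<ge> N\<close>
  have not started at \<open>x\<close>: the series is locally finite.\<close>

lemma ramp_sum_eq_sum:
  assumes "x \<le> real N"
  shows "ramp_sum s x = (\<Sum>n<N. min 1 (max 0 (x - s n)))"
  unfolding ramp_sum_def using assms by (intro suminf_finite) (auto intro!: ramp_eq_0)

lemma summable_ramps: "summable (\<lambda>n. min 1 (max 0 (x - s n)))"
proof -
  obtain N where "x \<le> real N" using real_arch_simple by blast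
  then show ?thesis by (intro summable_finite[of "{..<N}"]) (auto intro!: ramp_eq_0)
qed

lemma ramp_sum_0: "ramp_sum s 0 = 0"
  using ramp_sum_eq_sum[of 0 0] by simp

lemma ramp_sum_mono: "x \<le> y \<Longrightarrow> ramp_sum s x \<le> ramp_sum s y"
  unfolding ramp_sum_def by (intro suminf_le summable_ramps) auto

lemma filterlim_ramp_sum: "filterlim (ramp_sum s) at_top at_top"
  unfolding filterlim_at_top
proof
  fix Z :: real
  obtain N :: nat where N: "Z \<le> real N" using real_arch_simple by blast
  \<comment> \<open>All levels are nonnegative, so their sum over \<open>n < N\<close> dominates
    each of them; the added 1 lets all \<open>N\<close> ramps reach height 1.\<close>
  define x0 where "x0 = (\<Sum>n<N. s n) + 1"
  have "Z \<le> ramp_sum s x" if "x0 \<le> x" for x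
  proof -
    have "1 \<le> min 1 (max 0 (x - s n))" if "n < N" for n
    proof -
      have "s n \<le> (\<Sum>n<N. s n)"
        using that real_le by (intro member_le_sum) (auto intro: order_trans[OF of_nat_0_le_iff])
      then show ?thesis using \<open>x0 \<le> x\<close> by (simp add: x0_def)
    qed
    then have "(\<Sum>n<N. 1) \<le> (\<Sum>n<N. min 1 (max 0 (x - s n)))"
      by (intro sum_mono) auto
    also have "\<dots> \<le> ramp_sum s x"
      unfolding ramp_sum_def by (intro sum_le_suminf summable_ramps) auto
    finally show ?thesis using N by simp
  qed
  then show "\<forall>\<^sub>F x in at_top. Z \<le> ramp_sum s x"
    by (auto simp: eventually_at_top_linorder)
qed

text \<open>On each open half-line \<open>{..<real N}\<close> the series is a fixed finite sum, and
  these half-lines cover the line.\<close>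

lemma continuous_on_ramp_sum: "continuous_on UNIV (ramp_sum s)"
proof -
  have "continuous_on {..<real N} (ramp_sum s)" for N
  proof -
    have "continuous_on {..<real N} (\<lambda>x. \<Sum>n<N. min 1 (max 0 (x - s n)))"
      by (intro continuous_intros)
    then show ?thesis
      by (rule continuous_on_eq) (auto intro!: ramp_sum_eq_sum[symmetric])
  qed
  then have "continuous_on (\<Union>N. {..<real N}) (ramp_sum s)"
    by (intro continuous_on_open_UN) auto
  moreover have "(\<Union>N. {..<real N}) = UNIV"
    using reals_Archimedean2 by auto
  ultimately show ?thesis by simp
qed

text \<open>A ramp is at most 1 and vanishes when \<open>\<bar>x\<bar> \<le> s n\<close>.
  Integrating turns the right-hand side into a sum of tails.\<close>

lemma ennreal_ramp_sum_le:
  "ennreal (ramp_sum s \<bar>x\<bar>) \<le> (\<Sum>n. indicator (- {- s n..s n}) x)"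
proof -
  have "ennreal (ramp_sum s \<bar>x\<bar>) = (\<Sum>n. ennreal (min 1 (max 0 (\<bar>x\<bar> - s n))))"
    unfolding ramp_sum_def by (intro suminf_ennreal2[symmetric] summable_ramps) auto
  also have "\<dots> \<le> (\<Sum>n. indicator (- {- s n..s n}) x)"
    by (intro suminf_le) (auto simp: indicator_def abs_le_iff max_def)
  finally show ?thesis .
qed

end

lemma tight_imp_bounding_function:
  assumes K: "K \<subseteq> borel_probs" and tight: "tight_family K"
  shows "\<exists>\<psi>. bounding_function K \<psi> \<and> continuous_on {0..} \<psi> \<and> strict_mono_on {0..} \<psi>"
proof -
  have "\<exists>t. real n \<le> t \<and> (\<forall>\<mu>\<in>K. measure \<mu> (- {- t..t}) \<le> (1 / 2) ^ n)" for n
  proof -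
    obtain t where t: "\<forall>\<mu>\<in>K. measure \<mu> (- {- t..t}) \<le> (1 / 2) ^ n"
      using tight unfolding tight_family_iff[OF K] by (meson half_gt_zero zero_less_power zero_less_one)
    \<comment> \<open>Raising the level to at least \<open>n\<close> only shrinks the tail.\<close>
    have "measure \<mu> (- {- max t n..max t n}) \<le> (1 / 2) ^ n" if "\<mu> \<in> K" for \<mu>
    proof -
      interpret real_distribution \<mu> using K that by (auto intro: borel_probsD)
      have "measure \<mu> (- {- max t n..max t n}) \<le> measure \<mu> (- {- t..t})"
        by (intro finite_measure_mono) auto
      then show ?thesis using t that by (meson order_trans)
    qed
    then show ?thesis by (intro exI[of _ "max t n"]) auto
  qed
  then obtain s where s: "\<And>n. real n \<le> s n"
    and tail: "\<And>n \<mu>. \<mu> \<in> K \<Longrightarrow> measure \<mu> (- {- s n..s n}) \<le> (1 / 2) ^ n"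
    by metis
  define \<psi> where "\<psi> x = (1 - exp (- x)) + ramp_sum s x" for x
  have strict: "\<psi> x < \<psi> y" if "x < y" for x y
    using that ramp_sum_mono[OF s, of x y] by (simp add: \<psi>_def add_less_le_mono)
  have zero: "\<psi> 0 = 0" by (simp add: \<psi>_def ramp_sum_0[OF s])
  have mono: "x \<le> y \<Longrightarrow> \<psi> x \<le> \<psi> y" for x y
    using strict[of x y] by (cases "x = y") auto
  have "filterlim \<psi> at_top at_top"
  proof (rule filterlim_at_top_mono[OF filterlim_ramp_sum[OF s]])
    show "\<forall>\<^sub>F x in at_top. ramp_sum s x \<le> \<psi> x"
      using eventually_ge_at_top[of 0] by eventually_elim (simp add: \<psi>_def)
  qed
  \<comment> \<open>The term \<open>1 - exp (- x)\<close> contributes at most 1, and the tails sum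
    to at most the geometric series with value 2.\<close>
  moreover have "(\<Squnion>\<mu>\<in>K. \<integral>\<^sup>+x. ennreal (\<psi> \<bar>x\<bar>) \<partial>\<mu>) \<le> 1 + ennreal 2"
  proof (rule SUP_least)
    fix \<mu> assume \<mu>: "\<mu> \<in> K"
    interpret real_distribution \<mu> using K \<mu> by (auto intro: borel_probsD)
    have "ennreal (\<psi> \<bar>x\<bar>) \<le> 1 + (\<Sum>n. indicator (- {- s n..s n}) x)" for x
    proof -
      have "0 \<le> ramp_sum s \<bar>x\<bar>"
        using ramp_sum_mono[OF s, of 0 "\<bar>x\<bar>"] by (simp add: ramp_sum_0[OF s])
      then have "ennreal (\<psi> \<bar>x\<bar>) \<le> ennreal (1 + ramp_sum s \<bar>x\<bar>)"
        by (intro ennreal_leI) (simp add: \<psi>_def)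
      also have "\<dots> = 1 + ennreal (ramp_sum s \<bar>x\<bar>)"
        using \<open>0 \<le> ramp_sum s \<bar>x\<bar>\<close> by simp
      also have "\<dots> \<le> 1 + (\<Sum>n. indicator (- {- s n..s n}) x)"
        by (intro add_left_mono ennreal_ramp_sum_le s)
      finally show ?thesis .
    qed
    then have "(\<integral>\<^sup>+x. ennreal (\<psi> \<bar>x\<bar>) \<partial>\<mu>) \<le> (\<integral>\<^sup>+x. 1 + (\<Sum>n. indicator (- {- s n..s n}) x) \<partial>\<mu>)"
      by (intro nn_integral_mono)
    also have "\<dots> = 1 + (\<Sum>n. emeasure \<mu> (- {- s n..s n}))"
      by (subst nn_integral_add) (auto simp: nn_integral_suminf emeasure_space_1[simplified])
    also have "(\<Sum>n. emeasure \<mu> (- {- s n..s n})) \<le> (\<Sum>n. ennreal ((1 / 2) ^ n))"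
      using tail[OF \<mu>] by (intro suminf_le) (auto simp: emeasure_eq_measure intro!: ennreal_leI)
    also have "\<dots> = ennreal 2"
      by (subst suminf_ennreal2) (auto simp: suminf_geometric)
    finally show "(\<integral>\<^sup>+x. ennreal (\<psi> \<bar>x\<bar>) \<partial>\<mu>) \<le> 1 + ennreal 2" by simp
  qed
  then have "(\<Squnion>\<mu>\<in>K. \<integral>\<^sup>+x. ennreal (\<psi> \<bar>x\<bar>) \<partial>\<mu>) < \<infinity>"
    by (rule le_less_trans) simp
  ultimately have "bounding_function K \<psi>"
    using zero mono mono[of 0] by (simp add: bounding_function_def mono_on_def)
  moreover have "continuous_on {0..} \<psi>"
    unfolding \<psi>_def
    by (intro continuous_intros continuous_on_subset[OF continuous_on_ramp_sum[OF s]]) auto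
  moreover have "strict_mono_on {0..} \<psi>"
    by (auto simp: strict_mono_on_def strict)
  ultimately show ?thesis by blast
qed

lemma bounding_function_bound:
  assumes "bounding_function K \<psi>"
  obtains C where "0 \<le> C" "\<And>\<mu>. \<mu> \<in> K \<Longrightarrow> (\<integral>\<^sup>+x. ennreal (\<psi> \<bar>x\<bar>) \<partial>\<mu>) \<le> ennreal C"
proof
  let ?S = "\<Squnion>\<mu>\<in>K. \<integral>\<^sup>+x. ennreal (\<psi> \<bar>x\<bar>) \<partial>\<mu>"
  have "?S < \<infinity>" using assms by (simp add: bounding_function_def)
  then have "?S = ennreal (enn2real ?S)" by simp
  then show "(\<integral>\<^sup>+x. ennreal (\<psi> \<bar>x\<bar>) \<partial>\<mu>) \<le> ennreal (enn2real ?S)" if "\<mu> \<in> K" for \<mu>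
    using SUP_upper[OF that, of "\<lambda>\<mu>. \<integral>\<^sup>+x. ennreal (\<psi> \<bar>x\<bar>) \<partial>\<mu>"] by simp
qed simp

lemma bounding_function_imp_tight:
  assumes K: "K \<subseteq> borel_probs" and \<psi>: "bounding_function K \<psi>"
  shows "tight_family K"
  unfolding tight_family_iff[OF K]
proof (intro allI impI)
  fix e :: real assume "0 < e"
  obtain C where C: "0 \<le> C" "\<And>\<mu>. \<mu> \<in> K \<Longrightarrow> (\<integral>\<^sup>+x. ennreal (\<psi> \<bar>x\<bar>) \<partial>\<mu>) \<le> ennreal C"
    using bounding_function_bound[OF \<psi>] by blast
  \<comment> \<open>The part \<open>C / e\<close> gives \<open>C \<le> \<psi> s * e\<close>; the
    part 1 makes \<open>\<psi> s\<close> positive, so that it can be cancelled at the end.\<close>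
  have "\<forall>\<^sub>F s in at_top. max 1 (C / e) \<le> \<psi> s"
    using \<psi> unfolding bounding_function_def filterlim_at_top by blast
  then have "\<forall>\<^sub>F s in at_top. max 1 (C / e) \<le> \<psi> s \<and> 0 \<le> s"
    using eventually_ge_at_top[of 0] by eventually_elim simp
  then obtain s where s: "max 1 (C / e) \<le> \<psi> s" "0 \<le> s"
    by (auto simp: eventually_at_top_linorder)
  have "measure \<mu> (- {- s..s}) \<le> e" if \<mu>: "\<mu> \<in> K" for \<mu>
  proof -
    interpret real_distribution \<mu> using K \<mu> by (auto intro: borel_probsD)
    have "ennreal (\<psi> s * measure \<mu> (- {- s..s})) = (\<integral>\<^sup>+x. ennreal (\<psi> s) * indicator (- {- s..s}) x \<partial>\<mu>)"
      using s by (simp add: nn_integral_cmult_indicator emeasure_eq_measure ennreal_mult')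
    \<comment> \<open>Markov's inequality: outside \<open>{- s..s}\<close> one has
      \<open>s \<le> \<bar>x\<bar>\<close>, hence
      \<open>\<psi> s \<le> \<psi> \<bar>x\<bar>\<close>.\<close>
    also have "\<dots> \<le> (\<integral>\<^sup>+x. ennreal (\<psi> \<bar>x\<bar>) \<partial>\<mu>)"
      using \<psi> s
      by (intro nn_integral_mono)
        (auto simp: indicator_def bounding_function_def intro!: ennreal_leI elim!: mono_onD)
    also have "\<dots> \<le> ennreal C" using C(2)[OF \<mu>] .
    finally have "\<psi> s * measure \<mu> (- {- s..s}) \<le> C"
      using C(1) by (simp add: ennreal_le_iff)
    also have "C \<le> \<psi> s * e"
      using s(1) \<open>0 < e\<close> by (simp add: field_simps)
    finally show ?thesis using s(1) by simp
  qed
  then show "\<exists>s. \<forall>\<mu>\<in>K. measure \<mu> (- {- s..s}) \<le> e" by blast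
qed

section \<open>Convex growth functions and first moments\<close>

text \<open>Convexity and \<open>\<psi> 0 = 0\<close> make \<open>\<psi> x / x\<close>
  nondecreasing, so beyond a point \<open>a\<close> with \<open>\<psi> a \<ge> 1\<close> one has
  \<open>x \<le> a * \<psi> x\<close>; below \<open>a\<close> the constant \<open>a\<close>
  suffices.\<close>

lemma convex_bounding_function_imp_first_moment:
  assumes K: "K \<subseteq> borel_probs" and \<psi>: "bounding_function K \<psi>" and conv: "convex_on {0..} \<psi>"
  shows "(\<Squnion>\<mu>\<in>K. \<integral>\<^sup>+x. ennreal \<bar>x\<bar> \<partial>\<mu>) < \<infinity>"
proof -
  obtain C where C: "0 \<le> C" "\<And>\<mu>. \<mu> \<in> K \<Longrightarrow> (\<integral>\<^sup>+x. ennreal (\<psi> \<bar>x\<bar>) \<partial>\<mu>) \<le> ennreal C"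
    using bounding_function_bound[OF \<psi>] by blast
  have nonneg: "0 \<le> x \<Longrightarrow> 0 \<le> \<psi> x" and mono: "mono_on {0..} \<psi>" and zero: "\<psi> 0 = 0" for x
    using \<psi> by (auto simp: bounding_function_def)
  have "\<forall>\<^sub>F a in at_top. 1 \<le> \<psi> a"
    using \<psi> by (simp add: bounding_function_def filterlim_at_top)
  then have "\<forall>\<^sub>F a in at_top. 1 \<le> \<psi> a \<and> 0 < a"
    using eventually_gt_at_top[of 0] by eventually_elim simp
  then obtain a where a: "1 \<le> \<psi> a" "0 < a"
    by (auto simp: eventually_at_top_linorder)
  have lin: "x \<le> a + a * \<psi> x" if "0 \<le> x" for x
  proof (cases "x \<le> a")
    case True
    then show ?thesis using nonneg[OF that] a by (simp add: add_increasing2)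
  next
    case False
    \<comment> \<open>The point \<open>a\<close> is the convex combination of 0 and \<open>x\<close>
      with weight \<open>a / x\<close> on \<open>x\<close>.\<close>
    then have "\<psi> ((1 - a / x) *\<^sub>R 0 + (a / x) *\<^sub>R x) \<le> (1 - a / x) * \<psi> 0 + a / x * \<psi> x"
      using a by (intro convex_onD[OF conv]) auto
    then have "\<psi> a \<le> a / x * \<psi> x" using False a zero by simp
    then have "1 \<le> a / x * \<psi> x" using a by simp
    then show ?thesis using False a by (simp add: field_simps)
  qed
  \<comment> \<open>Monotonicity is known only on the half-line; extending by the value at 0 gives a
    monotone, hence Borel, function on the whole line.\<close>
  have "mono (\<lambda>x. \<psi> (max 0 x))"
    by (intro monoI mono_onD[OF mono]) auto
  then have meas: "(\<lambda>x. \<psi> (max 0 x)) \<in> borel_measurable borel" by (rule borel_measurable_mono)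
  have [measurable]: "(\<lambda>x. \<psi> \<bar>x\<bar>) \<in> borel_measurable borel"
    using measurable_compose[OF _ meas, of abs] by simp
  have "(\<Squnion>\<mu>\<in>K. \<integral>\<^sup>+x. ennreal \<bar>x\<bar> \<partial>\<mu>) \<le> ennreal a + ennreal a * ennreal C"
  proof (rule SUP_least)
    fix \<mu> assume \<mu>: "\<mu> \<in> K"
    interpret real_distribution \<mu> using K \<mu> by (auto intro: borel_probsD)
    have "ennreal \<bar>x\<bar> \<le> ennreal a + ennreal a * ennreal (\<psi> \<bar>x\<bar>)" for x
      using lin[of "\<bar>x\<bar>"] nonneg[of "\<bar>x\<bar>"] a
      by (simp add: ennreal_plus[symmetric] ennreal_mult[symmetric] ennreal_leI del: ennreal_plus)
    then have "(\<integral>\<^sup>+x. ennreal \<bar>x\<bar> \<partial>\<mu>) \<le> (\<integral>\<^sup>+x. ennreal a + ennreal a * ennreal (\<psi> \<bar>x\<bar>) \<partial>\<mu>)"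
      by (intro nn_integral_mono)
    also have "\<dots> = ennreal a + ennreal a * (\<integral>\<^sup>+x. ennreal (\<psi> \<bar>x\<bar>) \<partial>\<mu>)"
      by (subst nn_integral_add) (auto simp: nn_integral_cmult emeasure_space_1[simplified])
    also have "\<dots> \<le> ennreal a + ennreal a * ennreal C"
      by (intro add_left_mono mult_left_mono C(2)[OF \<mu>]) auto
    finally show "(\<integral>\<^sup>+x. ennreal \<bar>x\<bar> \<partial>\<mu>) \<le> ennreal a + ennreal a * ennreal C" .
  qed
  also have "\<dots> < \<infinity>" by (simp add: ennreal_mult_less_top)
  finally show ?thesis .
qed

text \<open>The identity is also continuous, strictly increasing and convex, so it is the witness
  whenever first moments are bounded.\<close>

lemma bounding_function_ident:
  assumes "(\<Squnion>\<mu>\<in>K. \<integral>\<^sup>+x. ennreal \<bar>x\<bar> \<partial>\<mu>) < \<infinity>"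
  shows "bounding_function K (\<lambda>x. x)"
  using assms by (auto simp: bounding_function_def mono_on_def filterlim_ident)

theorem lemma3p4:
  fixes K :: "real measure set"
  assumes "K \<subseteq> borel_probs"
  shows "(tight_family K \<longleftrightarrow> st_bounded K) \<and>
    (st_bounded K \<longleftrightarrow> subsets_have_lub_glb K) \<and>
    (subsets_have_lub_glb K \<longleftrightarrow> (\<exists>\<psi>. bounding_function K \<psi>)) \<and>
    ((\<exists>\<psi>. bounding_function K \<psi>) \<longrightarrow>
      (\<exists>\<psi>. bounding_function K \<psi> \<and> continuous_on {0..} \<psi> \<and> strict_mono_on {0..} \<psi>)) \<and>
    ((\<exists>\<psi>. bounding_function K \<psi> \<and> convex_on {0..} \<psi>) \<longleftrightarrow>
      (\<Squnion>\<mu>\<in>K. \<integral>\<^sup>+x. ennreal \<bar>x\<bar> \<partial>\<mu>) < \<infinity>) \<and>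
    ((\<exists>\<psi>. bounding_function K \<psi> \<and> continuous_on {0..} \<psi> \<and> strict_mono_on {0..} \<psi> \<and>
        convex_on {0..} \<psi>) \<longleftrightarrow>
      (\<Squnion>\<mu>\<in>K. \<integral>\<^sup>+x. ennreal \<bar>x\<bar> \<partial>\<mu>) < \<infinity>)"
proof -
  have i_iii: "tight_family K \<Longrightarrow> subsets_have_lub_glb K"
    using assms by (rule tight_imp_subsets_have_lub_glb)
  have iii_ii: "subsets_have_lub_glb K \<Longrightarrow> st_bounded K"
    using assms by (rule subsets_have_lub_glb_imp_st_bounded)
  have ii_i: "st_bounded K \<Longrightarrow> tight_family K"
    using assms by (rule st_bounded_imp_tight)
  have i_iv: "tight_family K \<Longrightarrow>
      \<exists>\<psi>. bounding_function K \<psi> \<and> continuous_on {0..} \<psi> \<and> strict_mono_on {0..} \<psi>"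
    using assms by (rule tight_imp_bounding_function)
  have iv_i: "\<exists>\<psi>. bounding_function K \<psi> \<Longrightarrow> tight_family K"
    using bounding_function_imp_tight[OF assms] by blast
  have "\<exists>\<psi>. bounding_function K \<psi> \<and> convex_on {0..} \<psi> \<Longrightarrow>
      (\<Squnion>\<mu>\<in>K. \<integral>\<^sup>+x. ennreal \<bar>x\<bar> \<partial>\<mu>) < \<infinity>"
    using convex_bounding_function_imp_first_moment[OF assms] by blast
  \<comment> \<open>This one witness settles both convexity equivalences, with and without
    continuity and strict monotonicity.\<close>
  moreover have "\<exists>\<psi>. bounding_function K \<psi> \<and> continuous_on {0..} \<psi> \<and> strict_mono_on {0..} \<psi> \<and>
      convex_on {0..} \<psi>" if "(\<Squnion>\<mu>\<in>K. \<integral>\<^sup>+x. ennreal \<bar>x\<bar> \<partial>\<mu>) < \<infinity>"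
    using bounding_function_ident[OF that]
    by (intro exI[of _ "\<lambda>x. x"]) (auto simp: strict_mono_on_def convex_on_def)
  ultimately show ?thesis
    using i_iii iii_ii ii_i i_iv iv_i by blast
qed

end
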